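(* (a) Let $X$ be a non-empty set and let $S\subseteq \mathrm{Der}(X)$ be a finite non-empty set of derangements of $X$. Then the following three conditions are equivalent: (1) the group action digraph $\overrightarrow{\mathrm{GA}}(X,S)$ is multiplicity-free; (2) $SS^{-1}\subseteq \mathrm{Der}(X)\cup\{1\}$; (3) the derangement action digraph $\overrightarrow{\mathrm{DA}}(X,S)$ is regular of valency $|S|$. (b) Every finite simple regular digraph is a derangement action digraph.
   Context: For a set $X$, $\mathrm{Sym}(X)$ is the group of all permutations of $X$, acting on the right: $x^s$ is the image of $x$ under $s$, and $x^{st}=(x^s)^t$. A derangement of $X$ is a permutation of $X$ with no fixed points; $\mathrm{Der}(X)$ is the set of derangements of $X$. For subsets $A,B\subseteq\mathrm{Sym}(X)$, $AB=\{ab : a\in A,b\in B\}$ and $A^{-1}=\{a^{-1}: a\in A\}$; $1$ denotes the identity permutation. A simple digraph is a pair $\Gamma=(X,A)$ with vertex set $X$ and arc set $A\subseteq\{(u,v): u,v\in X, u\neq v\}$. If $(x,y)\in A$ then $y$ is an out-neighbour of $x$ and $x$ is an in-neighbour of $y$; the out-valency (in-valency) of $x$ is its number of out-neighbours (in-neighbours). $\Gamma$ is regular of valency $k$ if every vertex has out-valency $k$ and in-valency $k$, and regular if this holds for some constant $k$. For non-empty $X$ and non-empty $S\subseteq \mathrm{Der}(X)$, the derangement action digraph $\overrightarrow{\mathrm{DA}}(X,S)$ is the simple digraph with vertex set $X$ and arc set $\{(x,x^s): x\in X, s\in S\}$ (a set of ordered pairs, without multiplicities). A simple digraph is called a derangement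 action digraph if it equals $\overrightarrow{\mathrm{DA}}(X,S)$ for some such $X$ and $S$. The group action digraph $\overrightarrow{\mathrm{GA}}(X,S)$ has vertex set $X$ and, for each $x\in X$ and $s\in S$, an arc labelled $s$ from $x$ to $x^s$; it is multiplicity-free if for all $(v,u)\in X\times X$ there is at most one $s\in S$ with $v^s=u$.
   Formalization: In (b) the digraph is assumed to have at least one arc: digraphs without arcs are regular of valency 0, but are not derangement action digraphs, because X and S are required to be non-empty. *)

theory Defs
  imports "HOL-Combinatorics.Permutations" "Graph_Theory.Graph_Theory"
begin

definition Sym :: "'a set \<Rightarrow> ('a \<Rightarrow> 'a) set" where
  "Sym X = {s. s permutes X}"

definition Der :: "'a set \<Rightarrow> ('a \<Rightarrow> 'a) set" where
  "Der X = {s \<in> Sym X. \<forall>x\<in>X. s x \<noteq> x}"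

text \<open>Permutations act on the right: the image of x under s, written s x here, satisfies
  x^(st) = (x^s)^t, so the product st is the composition t o s.\<close>

definition perm_prod :: "('a \<Rightarrow> 'a) \<Rightarrow> ('a \<Rightarrow> 'a) \<Rightarrow> 'a \<Rightarrow> 'a" where
  "perm_prod s t = t \<circ> s"

definition set_prod :: "('a \<Rightarrow> 'a) set \<Rightarrow> ('a \<Rightarrow> 'a) set \<Rightarrow> ('a \<Rightarrow> 'a) set" where
  "set_prod A B = {perm_prod a b | a b. a \<in> A \<and> b \<in> B}"

text \<open>Permutations of X are extended by the identity outside X, so the inverse in the group
  of permutations of X is the inverse on the whole type.\<close>

definition set_inv :: "('a \<Rightarrow> 'a) set \<Rightarrow> ('a \<Rightarrow> 'a) set" where
  "set_inv A = inv ` A"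

text \<open>A simple digraph is a \<^typ>\<open>'a pair_pre_digraph\<close> satisfying
  \<^locale>\<open>pair_loopfree_digraph\<close>; with a finite vertex set, it satisfies
  \<^locale>\<open>pair_digraph\<close>. In a simple digraph the arcs leaving (entering) a vertex correspond
  to its out-neighbours (in-neighbours). The finiteness conjuncts are needed because the degrees are
  cardinalities in the natural numbers, where infinite sets have cardinality 0.\<close>

definition regular_of_valency :: "'a pair_pre_digraph \<Rightarrow> nat \<Rightarrow> bool" where
  "regular_of_valency G k \<longleftrightarrow>
     (\<forall>x\<in>pverts G. finite (out_arcs (with_proj G) x) \<and> out_degree (with_proj G) x = k \<and>
                    finite (in_arcs (with_proj G) x) \<and> in_degree (with_proj G) x = k)"

definition regular_digraph :: "'a pair_pre_digraph \<Rightarrow> bool" where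
  "regular_digraph G \<longleftrightarrow> (\<exists>k. regular_of_valency G k)"

definition DA :: "'a set \<Rightarrow> ('a \<Rightarrow> 'a) set \<Rightarrow> 'a pair_pre_digraph" where
  "DA X S = \<lparr> pverts = X, parcs = {(x, s x) | x s. x \<in> X \<and> s \<in> S} \<rparr>"

definition derangement_action_digraph :: "'a pair_pre_digraph \<Rightarrow> bool" where
  "derangement_action_digraph G \<longleftrightarrow>
     (\<exists>X S. X \<noteq> {} \<and> S \<noteq> {} \<and> S \<subseteq> Der X \<and> G = DA X S)"

text \<open>The arc (x, s) of the group action digraph is the arc labelled s from x to s x.\<close>

definition GA :: "'a set \<Rightarrow> ('a \<Rightarrow> 'a) set \<Rightarrow> ('a, 'a \<times> ('a \<Rightarrow> 'a)) pre_digraph" where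
  "GA X S = \<lparr> verts = X, arcs = X \<times> S, tail = fst, head = (\<lambda>(x, s). s x) \<rparr>"

definition multiplicity_free :: "('a, 'b) pre_digraph \<Rightarrow> bool" where
  "multiplicity_free G \<longleftrightarrow>
     (\<forall>v\<in>verts G. \<forall>u\<in>verts G. \<exists>\<^sub>\<le>\<^sub>1 e. e \<in> arcs G \<and> tail G e = v \<and> head G e = u)"

lemma multiplicity_free_GA_iff:
  "multiplicity_free (GA X S) \<longleftrightarrow> (\<forall>v\<in>X. \<forall>u\<in>X. \<exists>\<^sub>\<le>\<^sub>1 s. s \<in> S \<and> s v = u)"
  by (fastforce simp: multiplicity_free_def GA_def Uniq_def)

lemma pair_loopfree_digraph_DA:
  assumes "S \<subseteq> Der X"
  shows "pair_loopfree_digraph (DA X S)"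
proof
  fix e assume "e \<in> parcs (DA X S)"
  then obtain x s where e: "e = (x, s x)" "x \<in> X" "s \<in> Der X"
    using assms by (auto simp: DA_def)
  then have "s permutes X" "s x \<noteq> x" by (auto simp: Der_def Sym_def)
  with e show "fst e \<in> pverts (DA X S)" "snd e \<in> pverts (DA X S)" "fst e \<noteq> snd e"
    by (auto simp: DA_def permutes_in_image)
qed

text \<open>A derangement action digraph has at least one arc, so arcless digraphs, which are regular of
  valency 0, are not derangement action digraphs.\<close>

lemma derangement_action_digraph_parcs_nonempty:
  assumes "derangement_action_digraph G"
  shows "parcs G \<noteq> {}"
  using assms by (auto simp: derangement_action_digraph_def DA_def)

end

theory Submission
  imports Defs
begin

text \<open>In part (a), the arcs of DA at \<open>x\<close> are the images of \<open>S\<close> under \<open>s \<mapsto> (x, s x)\<close> and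
  \<open>s \<mapsto> (inv s x, x)\<close>, and each of the three conditions says that two elements of \<open>S\<close> agreeing at a
  point of \<open>X\<close> are equal. In part (b), Hall's marriage theorem provides a permutation of the vertices
  moving every vertex along an arc; deleting the arcs that it uses lowers the valency by one, so the
  arc set decomposes into such permutations, which are derangements as there are no loops.\<close>

section \<open>Hall's marriage theorem\<close>

text \<open>This is the induction of Halmos and Vaughan. Either some nonempty proper subfamily
  covers exactly as many elements as it has indices, and the family splits there, or every such
  subfamily has an element to spare, and one index can be matched freely.\<close>

lemma hall_marriage:
  assumes "finite I" "\<And>i. i \<in> I \<Longrightarrow> finite (A i)"
    and "\<And>J. J \<subseteq> I \<Longrightarrow> card J \<le> card (\<Union>i\<in>J. A i)"
  shows "\<exists>f. inj_on f I \<and> (\<forall>i\<in>I. f i \<in> A i)"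
  using assms
proof (induction I arbitrary: A rule: finite_psubset_induct)
  case (psubset I)
  note fin = psubset.prems(1) and hall = psubset.prems(2)
  have finU: "finite (\<Union>i\<in>J. A i)" if "J \<subseteq> I" for J
    using that fin psubset.hyps by (auto intro: finite_subset)
  show ?case
  proof (cases "\<exists>J. J \<noteq> {} \<and> J \<subset> I \<and> card (\<Union>i\<in>J. A i) = card J")
    case True
    \<comment> \<open>A tight subfamily is matched on its own, and the rest avoids the elements it covers.\<close>
    then obtain J where J: "J \<noteq> {}" "J \<subset> I" and tight: "card (\<Union>i\<in>J. A i) = card J"
      by blast
    define U where "U = (\<Union>i\<in>J. A i)"
    have finJ: "finite J" and finU': "finite U"
      using J psubset.hyps finU by (auto simp: U_def intro: finite_subset)
    have "\<exists>f. inj_on f J \<and> (\<forall>i\<in>J. f i \<in> A i)"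
      using J fin hall by (intro psubset.IH) auto
    then obtain f where f: "inj_on f J" "\<forall>i\<in>J. f i \<in> A i" by blast
    \<comment> \<open>Hall's condition survives the removal of \<open>U\<close>: \<open>K\<close>
      and \<open>J\<close> together cover at least \<open>card K + card J\<close> elements, and by
      tightness only \<open>card J\<close> of these lie in \<open>U\<close>.\<close>
    have "card K \<le> card (\<Union>i\<in>K. A i - U)" if K: "K \<subseteq> I - J" for K
    proof -
      have finK: "finite K" using K psubset.hyps by (auto intro: finite_subset)
      have finKU: "finite (\<Union>i\<in>K. A i - U)"
        using K finU[of K] by (auto intro: finite_subset[rotated])
      have "card K + card J = card (K \<union> J)"
        using K finK finJ by (subst card_Un_disjoint) auto
      also have "\<dots> \<le> card (\<Union>i\<in>K \<union> J. A i)"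
        using K J by (intro hall) auto
      also have "(\<Union>i\<in>K \<union> J. A i) = (\<Union>i\<in>K. A i - U) \<union> U"
        by (auto simp: U_def)
      also have "card \<dots> = card (\<Union>i\<in>K. A i - U) + card J"
        using finKU finU' tight by (subst card_Un_disjoint) (auto simp: U_def)
      finally show ?thesis by simp
    qed
    then have "\<exists>g. inj_on g (I - J) \<and> (\<forall>i\<in>I - J. g i \<in> A i - U)"
      using J fin by (intro psubset.IH) auto
    then obtain g where g: "inj_on g (I - J)" "\<forall>i\<in>I - J. g i \<in> A i - U" by blast
    let ?h = "\<lambda>i. if i \<in> J then f i else g i"
    have "f ` J \<subseteq> U" "g ` (I - J) \<inter> U = {}" using f(2) g(2) by (auto simp: U_def)
    then have "inj_on ?h (J \<union> (I - J))"
      using f(1) g(1) by (intro inj_on_disjoint_Un) auto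
    then have "inj_on ?h I" using J by (simp add: Un_absorb1 psubset_imp_subset)
    moreover have "\<forall>i\<in>I. ?h i \<in> A i" using f g by auto
    ultimately show ?thesis by blast
  next
    case slack: False
    show ?thesis
    proof (cases "I = {}")
      case False
      then obtain i where i: "i \<in> I" by blast
      have "card {i} \<le> card (A i)" using hall[of "{i}"] i by simp
      then obtain x where x: "x \<in> A i" by fastforce
      \<comment> \<open>A nonempty proper subfamily is not tight, so it covers more elements than it
        has indices; this surplus pays for the possible loss of \<open>x\<close>.\<close>
      have "card K \<le> card (\<Union>j\<in>K. A j - {x})" if K: "K \<subseteq> I - {i}" for K
      proof (cases "K = {}")
        case False
        have "K \<subset> I" using K i by blast
        then have "card K \<noteq> card (\<Union>j\<in>K. A j)" using slack False by metis
        moreover have "card K \<le> card (\<Union>j\<in>K. A j)" using hall K by blast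
        moreover have "card (\<Union>j\<in>K. A j) - 1 \<le> card ((\<Union>j\<in>K. A j) - {x})"
          by (simp add: card_Diff_singleton_if)
        moreover have "(\<Union>j\<in>K. A j - {x}) = (\<Union>j\<in>K. A j) - {x}" by blast
        ultimately show ?thesis by simp
      qed simp
      then have "\<exists>g. inj_on g (I - {i}) \<and> (\<forall>j\<in>I - {i}. g j \<in> A j - {x})"
        using i fin by (intro psubset.IH) auto
      then obtain g where g: "inj_on g (I - {i})" "\<forall>j\<in>I - {i}. g j \<in> A j - {x}" by blast
      then have "inj_on (g(i := x)) I" "\<forall>j\<in>I. (g(i := x)) j \<in> A j"
        using x by (auto simp: inj_on_def)
      then show ?thesis by blast
    qed simp
  qed
qed

section \<open>Decomposing regular relations into permutations\<close>

text \<open>Hall's condition follows by double counting: the \<open>k * card J\<close> arcs leaving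
  \<open>J\<close> all enter its out-neighbourhood, which receives only \<open>k\<close> arcs per
  vertex. Dividing by \<open>k\<close> requires \<open>k > 0\<close>.\<close>

lemma regular_rel_contains_permutation:
  assumes fin: "finite X" and A: "A \<subseteq> X \<times> X" and "k > 0"
    and out: "\<And>x. x \<in> X \<Longrightarrow> card (A `` {x}) = k"
    and "in": "\<And>y. y \<in> X \<Longrightarrow> card (A\<inverse> `` {y}) = k"
  shows "\<exists>s. s permutes X \<and> (\<forall>x\<in>X. (x, s x) \<in> A)"
proof -
  have finA: "finite (A `` {x})" "finite (A\<inverse> `` {x})" for x
    using A fin by (auto intro: finite_subset)
  have "card J \<le> card (\<Union>x\<in>J. A `` {x})" if J: "J \<subseteq> X" for J
  proof -
    let ?N = "\<Union>x\<in>J. A `` {x}"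
    have N: "?N \<subseteq> X" using A by auto
    have finJN: "finite J" "finite ?N" using J N fin by (auto intro: finite_subset)
    have "k * card J = card (SIGMA x:J. A `` {x})"
      using finJN finA J out by (subst card_SigmaI) (auto simp: subset_iff)
    \<comment> \<open>The arcs into \<open>?N\<close> are indexed by their heads, so swapping the
      components makes them comparable with the arcs out of \<open>J\<close>.\<close>
    also have "\<dots> \<le> card (prod.swap ` (SIGMA y:?N. A\<inverse> `` {y}))"
      using finJN finA by (intro card_mono finite_imageI finite_SigmaI) auto
    also have "\<dots> = card (SIGMA y:?N. A\<inverse> `` {y})"
      by (simp add: card_image)
    also have "\<dots> = (\<Sum>y\<in>?N. card (A\<inverse> `` {y}))"
      using finJN finA by (subst card_SigmaI) auto
    also have "\<dots> = k * card ?N"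
      using N "in" by (subst sum.cong[OF refl, where h = "\<lambda>_. k"]) auto
    finally show ?thesis using \<open>k > 0\<close> by simp
  qed
  then have "\<exists>f. inj_on f X \<and> (\<forall>x\<in>X. f x \<in> A `` {x})"
    using fin finA by (intro hall_marriage) auto
  then obtain f where f: "inj_on f X" "\<forall>x\<in>X. f x \<in> A `` {x}" by blast
  \<comment> \<open>The matching is extended by the identity, as \<open>permutes\<close> demands; on
    the finite set \<open>X\<close> its injectivity gives surjectivity.\<close>
  let ?s = "\<lambda>x. if x \<in> X then f x else x"
  have "inj_on ?s X" using f(1) by (simp add: inj_on_def)
  moreover have "?s ` X \<subseteq> X" using f A by auto
  ultimately have "bij_betw ?s X X"
    unfolding bij_betw_def using endo_inj_surj[OF fin] by blast
  then have "?s permutes X" by (rule bij_imp_permutes) simp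
  then show ?thesis using f by (intro exI[of _ ?s]) auto
qed

text \<open>Induction on the valency: removing the arcs of one permutation takes exactly one arc out
  of and one arc into every vertex.\<close>

lemma regular_rel_permutation_decomposition:
  assumes fin: "finite X" and "A \<subseteq> X \<times> X"
    and "\<And>x. x \<in> X \<Longrightarrow> card (A `` {x}) = k"
    and "\<And>y. y \<in> X \<Longrightarrow> card (A\<inverse> `` {y}) = k"
  shows "\<exists>S. (\<forall>s\<in>S. s permutes X) \<and> A = {(x, s x) | x s. x \<in> X \<and> s \<in> S}"
  using assms(2-)
proof (induction k arbitrary: A)
  case 0
  \<comment> \<open>Finiteness is what lets cardinality 0 mean emptiness.\<close>
  have "finite (A `` {x})" for x using 0(1) fin by (auto intro: finite_subset)
  then have "A = {}" using 0 by fastforce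
  then show ?case by (intro exI[of _ "{}"]) auto
next
  case (Suc k)
  obtain s where s: "s permutes X" "\<forall>x\<in>X. (x, s x) \<in> A"
    using regular_rel_contains_permutation[OF fin Suc.prems(1) zero_less_Suc Suc.prems(2,3)] by blast
  define B where "B = A - {(x, s x) | x. x \<in> X}"
  have "B `` {x} = A `` {x} - {s x}" if "x \<in> X" for x
    using that by (auto simp: B_def)
  then have out: "card (B `` {x}) = k" if "x \<in> X" for x
    using that s Suc.prems(2)[OF that] by (simp add: card_Diff_singleton)
  have inv_iff: "y = s x \<longleftrightarrow> x = inv s y" for x y
    using permutes_inv_eq[OF s(1)] by metis
  have inv_in: "inv s y \<in> X" if "y \<in> X" for y
    using that by (simp add: permutes_in_image[OF permutes_inv[OF s(1)]])
  \<comment> \<open>Since \<open>s\<close> is a bijection, the only deleted arc into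
    \<open>y\<close> comes from \<open>inv s y\<close>.\<close>
  have "B\<inverse> `` {y} = A\<inverse> `` {y} - {inv s y}" if "y \<in> X" for y
    using inv_in[OF that] inv_iff[of y] by (auto simp: B_def)
  moreover have "inv s y \<in> A\<inverse> `` {y}" if "y \<in> X" for y
    using s(2) inv_in[OF that] permutes_inverses(1)[OF s(1), of y] by force
  ultimately have "in": "card (B\<inverse> `` {y}) = k" if "y \<in> X" for y
    using that Suc.prems(3)[OF that] by (simp add: card_Diff_singleton)
  have "B \<subseteq> X \<times> X" using Suc.prems(1) by (auto simp: B_def)
  then obtain S where S: "\<forall>s\<in>S. s permutes X" "B = {(x, s x) | x s. x \<in> X \<and> s \<in> S}"
    using Suc.IH out "in" by meson
  have "A = B \<union> {(x, s x) | x. x \<in> X}" using s(2) by (auto simp: B_def)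
  then have "A = {(x, t x) | x t. x \<in> X \<and> t \<in> insert s S}" unfolding S(2) by blast
  then show ?case using s(1) S(1) by (intro exI[of _ "insert s S"]) auto
qed

section \<open>Derangement action digraphs\<close>

text \<open>The product of \<open>s\<close> with the inverse of \<open>t\<close> is
  \<open>inv t \<circ> s\<close>, which fixes \<open>x\<close> exactly when
  \<open>s x = t x\<close>. So it is a derangement when \<open>s\<close> and \<open>t\<close>
  disagree throughout \<open>X\<close>, and the identity when \<open>s = t\<close>.\<close>

lemma set_prod_inv_subset_iff:
  assumes "S \<subseteq> Der X"
  shows "set_prod S (set_inv S) \<subseteq> Der X \<union> {id} \<longleftrightarrow> (\<forall>x\<in>X. inj_on (\<lambda>s. s x) S)"
proof -
  have perm: "s permutes X" if "s \<in> S" for s using assms that by (auto simp: Der_def Sym_def)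
  have fixes_iff: "inv t (s x) = x \<longleftrightarrow> s x = t x" if "t \<in> S" for s t x
    using permutes_inv_eq[OF perm[OF that]] by metis
  have id_iff: "inv t \<circ> s = id \<longleftrightarrow> s = t" if "t \<in> S" for s t
    using fixes_iff[OF that] by (auto simp: fun_eq_iff)
  have "inv t \<circ> s \<in> Der X \<longleftrightarrow> (\<forall>x\<in>X. s x \<noteq> t x)" if "s \<in> S" "t \<in> S" for s t
    using that perm by (simp add: Der_def Sym_def fixes_iff permutes_compose permutes_inv)
  moreover have "set_prod S (set_inv S) \<subseteq> Der X \<union> {id} \<longleftrightarrow>
      (\<forall>s\<in>S. \<forall>t\<in>S. inv t \<circ> s \<in> Der X \<or> inv t \<circ> s = id)"
    by (fastforce simp: set_prod_def set_inv_def perm_prod_def)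
  ultimately have "set_prod S (set_inv S) \<subseteq> Der X \<union> {id} \<longleftrightarrow>
      (\<forall>s\<in>S. \<forall>t\<in>S. (\<forall>x\<in>X. s x \<noteq> t x) \<or> s = t)"
    using id_iff by simp
  then show ?thesis unfolding inj_on_def by blast
qed

lemma multiplicity_free_GA_iff_inj_on:
  assumes "S \<subseteq> Der X"
  shows "multiplicity_free (GA X S) \<longleftrightarrow> (\<forall>x\<in>X. inj_on (\<lambda>s. s x) S)"
proof -
  have "s x \<in> X" if "s \<in> S" "x \<in> X" for s x
    using assms that by (auto simp: Der_def Sym_def permutes_in_image)
  then show ?thesis unfolding multiplicity_free_GA_iff Uniq_def inj_on_def by blast
qed

text \<open>The out-degrees alone force injectivity, since the out-arcs at \<open>x\<close> are the
  image of the finite set \<open>S\<close> under \<open>s \<mapsto> (x, s x)\<close>. Conversely,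
  injectivity at every vertex also fixes the in-degrees.\<close>

lemma regular_of_valency_DA_iff:
  assumes "finite S" "S \<subseteq> Der X"
  shows "regular_of_valency (DA X S) (card S) \<longleftrightarrow> (\<forall>x\<in>X. inj_on (\<lambda>s. s x) S)"
proof -
  have perm: "s permutes X" if "s \<in> S" for s using assms that by (auto simp: Der_def Sym_def)
  have out: "out_arcs (with_proj (DA X S)) x = (\<lambda>s. (x, s x)) ` S" if "x \<in> X" for x
    using that by (auto simp: DA_def out_arcs_def)
  have inv_eq: "inv s x \<in> X \<longleftrightarrow> x \<in> X" "s (inv s x) = x" if "s \<in> S" for s x
    using permutes_inverses[OF perm[OF that]] permutes_in_image[OF permutes_inv[OF perm[OF that]]]
    by auto
  have "in": "in_arcs (with_proj (DA X S)) x = (\<lambda>s. (inv s x, x)) ` S" if "x \<in> X" for x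
  proof (rule set_eqI)
    fix e
    have eq: "y \<in> X \<and> s y = x \<longleftrightarrow> y = inv s x" if "s \<in> S" for s y
      using inv_eq[OF that] \<open>x \<in> X\<close> permutes_inv_eq[OF perm[OF that]] by metis
    have "e \<in> in_arcs (with_proj (DA X S)) x \<longleftrightarrow>
        (\<exists>s\<in>S. snd e = x \<and> fst e \<in> X \<and> s (fst e) = x)"
      by (cases e) (auto simp: DA_def in_arcs_def)
    also have "\<dots> \<longleftrightarrow> (\<exists>s\<in>S. e = (inv s x, x))"
      using eq by (intro bex_cong refl) (auto simp: prod_eq_iff)
    finally show "e \<in> in_arcs (with_proj (DA X S)) x \<longleftrightarrow> e \<in> (\<lambda>s. (inv s x, x)) ` S"
      by blast
  qed
  \<comment> \<open>If the arcs into \<open>x\<close> given by \<open>s\<close> and \<open>t\<close>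
    have the same tail, then \<open>s\<close> and \<open>t\<close> agree at that tail, so
    injectivity is applied at \<open>inv s x\<close> rather than at \<open>x\<close>.\<close>
  have inj_inv: "inj_on (\<lambda>s. (inv s x, x)) S" if "\<forall>x\<in>X. inj_on (\<lambda>s. s x) S" "x \<in> X" for x
  proof (rule inj_onI)
    fix s t assume st: "s \<in> S" "t \<in> S" "(inv s x, x) = (inv t x, x)"
    then have "s (inv s x) = t (inv s x)" "inv s x \<in> X"
      using inv_eq that by (metis Pair_inject)+
    then show "s = t" using that st by (auto dest: inj_onD)
  qed
  have "card ((\<lambda>s. (x, s x)) ` S) = card S \<longleftrightarrow> inj_on (\<lambda>s. s x) S" for x
    using assms(1) by (simp add: inj_on_def flip: inj_on_iff_eq_card)
  moreover have "pverts (DA X S) = X" by (simp add: DA_def)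
  ultimately show ?thesis
    using assms(1) inj_inv
    by (auto simp: regular_of_valency_def out_degree_def in_degree_def out "in" card_image)
qed

lemma regular_digraph_imp_derangement_action_digraph:
  assumes G: "pair_digraph G" and reg: "regular_digraph G" and ne: "parcs G \<noteq> {}"
  shows "derangement_action_digraph G"
proof -
  interpret pair_digraph G by fact
  let ?X = "pverts G" and ?A = "parcs G"
  have sub: "?A \<subseteq> ?X \<times> ?X" using in_arcsD1 in_arcsD2 by auto
  obtain k where k: "regular_of_valency G k" using reg by (auto simp: regular_digraph_def)
  have out: "card (?A `` {x}) = k" if "x \<in> ?X" for x
  proof -
    have "out_arcs (with_proj G) x = Pair x ` (?A `` {x})" by (auto simp: out_arcs_def)
    then have "out_degree (with_proj G) x = card (?A `` {x})"
      by (simp add: out_degree_def card_image inj_on_def)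
    then show ?thesis using k that by (simp add: regular_of_valency_def)
  qed
  have "in": "card (?A\<inverse> `` {y}) = k" if "y \<in> ?X" for y
  proof -
    have "in_arcs (with_proj G) y = (\<lambda>x. (x, y)) ` (?A\<inverse> `` {y})" by (auto simp: in_arcs_def)
    then have "in_degree (with_proj G) y = card (?A\<inverse> `` {y})"
      by (simp add: in_degree_def card_image inj_on_def)
    then show ?thesis using k that by (simp add: regular_of_valency_def)
  qed
  obtain S where S: "\<forall>s\<in>S. s permutes ?X" "?A = {(x, s x) | x s. x \<in> ?X \<and> s \<in> S}"
    using regular_rel_permutation_decomposition[OF _ sub out "in"] by auto
  have "s x \<noteq> x" if "s \<in> S" "x \<in> ?X" for s x
    using that S(2) no_loops by fastforce
  then have "S \<subseteq> Der ?X" using S(1) by (auto simp: Der_def Sym_def)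
  \<comment> \<open>An arc of \<open>G\<close> supplies both a vertex and an element of
    \<open>S\<close>.\<close>
  moreover have "?X \<noteq> {}" "S \<noteq> {}" using ne S(2) by auto
  moreover have "G = DA ?X S" unfolding DA_def S(2)[symmetric] by simp
  ultimately show ?thesis unfolding derangement_action_digraph_def by blast
qed

theorem theorem1p5:
  shows "(\<forall>(X :: 'a set) S. X \<noteq> {} \<and> finite S \<and> S \<noteq> {} \<and> S \<subseteq> Der X \<longrightarrow>
            (multiplicity_free (GA X S) \<longleftrightarrow> set_prod S (set_inv S) \<subseteq> Der X \<union> {id}) \<and>
            (set_prod S (set_inv S) \<subseteq> Der X \<union> {id} \<longleftrightarrow> regular_of_valency (DA X S) (card S))) \<and>
         (\<forall>G :: 'b pair_pre_digraph.
            pair_digraph G \<and> regular_digraph G \<and> parcs G \<noteq> {} \<longrightarrow> derangement_action_digraph G)"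
proof (intro conjI allI impI)
  fix X :: "'a set" and S assume "X \<noteq> {} \<and> finite S \<and> S \<noteq> {} \<and> S \<subseteq> Der X"
  then have S: "finite S" "S \<subseteq> Der X" by auto
  show "multiplicity_free (GA X S) \<longleftrightarrow> set_prod S (set_inv S) \<subseteq> Der X \<union> {id}"
    unfolding multiplicity_free_GA_iff_inj_on[OF S(2)] set_prod_inv_subset_iff[OF S(2)] ..
  show "set_prod S (set_inv S) \<subseteq> Der X \<union> {id} \<longleftrightarrow> regular_of_valency (DA X S) (card S)"
    unfolding set_prod_inv_subset_iff[OF S(2)] regular_of_valency_DA_iff[OF S] ..
qed (simp add: regular_digraph_imp_derangement_action_digraph)

end
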